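(* Consider a power network with constant power loads as described in the context. For every order $k\ge 1$, the order-$k$ transformed power flow equations (T-P), (T-Q), (T-V), (T-E), (T-F) of the context satisfy (i.e. take the form of), respectively, the following formally linear equations in $\mathbf{Y}(k)=[E_1(k),F_1(k),\dots,E_N(k),F_N(k)]^T\in\mathbb{R}^{2N}$ and $\Lambda(k)\in\mathbb{R}$: $$0=\mathbf{a}_{P,i}\mathbf{Y}(k)-\Delta p_i\Lambda(k)+\varepsilon_i,\qquad i\in\Omega_{PQ}\cup\Omega_{PV},$$ $$0=\mathbf{a}_{Q,i}\mathbf{Y}(k)-\Delta q_i\Lambda(k)+\mu_i,\qquad i\in\Omega_{PQ},$$ $$0=\mathbf{a}_{V,i}\mathbf{Y}(k)+0\,\Lambda(k)+\varsigma_i,\qquad i\in\Omega_{PV},$$ $$0=\mathbf{a}_{E,i}\mathbf{Y}(k)+0\,\Lambda(k)-e_i^{sp}\rho(k),\qquad 0=\mathbf{a}_{F,i}\mathbf{Y}(k)+0\,\Lambda(k)-f_i^{sp}\rho(k),\qquad i\in\Omega_{REF},$$ where the row vectors $\mathbf{a}_{P,i},\mathbf{a}_{Q,i},\mathbf{a}_{V,i},\mathbf{a}_{E,i},\mathbf{a}_{F,i}\in\mathbb{R}^{1\times 2N}$ and scalars $\varepsilon_i,\mu_i,\varsigma_i\in\mathbb{R}$ are the following. $\mathbf{a}_{P,i}=[\alpha_{i1},\beta_{i1},\dots,\alpha_{iN},\beta_{iN}]$ with, for $j\ne i$, $\alpha_{ij}=g_{ij}E_i(0)+b_{ij}F_i(0)$,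 $\beta_{ij}=g_{ij}F_i(0)-b_{ij}E_i(0)$, and $$\alpha_{ii}=\sum_{j=1}^N\big(g_{ij}E_j(0)-b_{ij}F_j(0)\big)+g_{ii}E_i(0)+b_{ii}F_i(0),\quad \beta_{ii}=\sum_{j=1}^N\big(b_{ij}E_j(0)+g_{ij}F_j(0)\big)-b_{ii}E_i(0)+g_{ii}F_i(0).$$ $\mathbf{a}_{Q,i}=[\phi_{i1},\psi_{i1},\dots,\phi_{iN},\psi_{iN}]$ with, for $j\neq i$, $\phi_{ij}=-b_{ij}E_i(0)+g_{ij}F_i(0)$, $\psi_{ij}=-b_{ij}F_i(0)-g_{ij}E_i(0)$, and $$\phi_{ii}=-\sum_{j=1}^N\big(b_{ij}E_j(0)+g_{ij}F_j(0)\big)-b_{ii}E_i(0)+g_{ii}F_i(0),\quad \psi_{ii}=\sum_{j=1}^N\big(g_{ij}E_j(0)-b_{ij}F_j(0)\big)-g_{ii}E_i(0)-b_{ii}F_i(0).$$ $\mathbf{a}_{V,i}$ has entries $2E_i(0)$ and $2F_i(0)$ in the positions of $E_i(k)$ and $F_i(k)$ and zeros elsewhere; $\mathbf{a}_{E,i}$ (resp. $\mathbf{a}_{F,i}$) has entry $1$ in the position of $E_i(k)$ (resp. $F_i(k)$) and zeros elsewhere. With $c_{ij}=\sum_{m=1}^{k-1}E_i(m)E_j(k-m)+\sum_{m=1}^{k-1}F_i(m)F_j(k-m)$ and $d_{ij}=\sum_{m=1}^{k-1}F_i(m)E_j(k-m)-\sum_{m=1}^{k-1}E_i(m)F_j(k-m)$,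 $$\varepsilon_i=\sum_{j=1}^N g_{ij}c_{ij}+\sum_{j=1}^N b_{ij}d_{ij}-p_i^{sp}\rho(k),\quad \mu_i=-\sum_{j=1}^N b_{ij}c_{ij}+\sum_{j=1}^N g_{ij}d_{ij}-q_i^{sp}\rho(k),\quad \varsigma_i=c_{ii}-(v_i^{sp})^2\rho(k).$$
   Context: Differential transformation (DT): for a real function $x(t)$, infinitely differentiable near $t=0$, its DT is the sequence of power series coefficients $X(k)=\frac{1}{k!}\frac{d^kx}{dt^k}(0)$, $k\ge 0$. Notation: $X(k)\otimes Y(k)=\sum_{m=0}^{k}X(m)Y(k-m)$ (discrete convolution). $\rho$ is the DT of the constant function $1$: $\rho(0)=1$, $\rho(k)=0$ for $k\ge1$. Empty sums are $0$. Network: $N$ buses, partitioned into PQ buses $\Omega_{PQ}$, PV buses $\Omega_{PV}$ and the reference bus $\Omega_{REF}$. Real numbers $g_{ij},b_{ij}$ ($1\le i,j\le N$) are the real and imaginary parts of the entries of the bus admittance matrix; $e_i(t),f_i(t)$ are the real and imaginary parts of the voltage phasor of bus $i$; $\lambda(t)$ is the loading parameter; $\Delta p_i,\Delta q_i,p_i^{sp},q_i^{sp},v_i^{sp},e_i^{sp},f_i^{sp}$ are given real constants. DTs of $e_i,f_i,\lambda$ are $E_i(k),F_i(k),\Lambda(k)$. Power flow equations (constant power load): $p_i^{sp}=-\lambda\Delta p_i+\sum_j g_{ij}(e_ie_j+f_if_j)+\sum_j b_{ij}(f_ie_j-e_if_j)$ for $i\in\Omega_{PQ}\cup\Omega_{PV}$;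 $q_i^{sp}=-\lambda\Delta q_i-\sum_j b_{ij}(e_ie_j+f_if_j)+\sum_j g_{ij}(f_ie_j-e_if_j)$ for $i\in\Omega_{PQ}$; $(v_i^{sp})^2=e_i^2+f_i^2$ for $i\in\Omega_{PV}$; $e_i^{sp}=e_i$, $f_i^{sp}=f_i$ for $i\in\Omega_{REF}$ (sums over $j=1,\dots,N$). Transformed (DT) power flow equations of order $k$: (T-P) $p_i^{sp}\rho(k)=-\Delta p_i\Lambda(k)+\sum_j g_{ij}(E_i(k)\otimes E_j(k)+F_i(k)\otimes F_j(k))+\sum_j b_{ij}(F_i(k)\otimes E_j(k)-E_i(k)\otimes F_j(k))$, $i\in\Omega_{PQ}\cup\Omega_{PV}$; (T-Q) $q_i^{sp}\rho(k)=-\Delta q_i\Lambda(k)-\sum_j b_{ij}(E_i(k)\otimes E_j(k)+F_i(k)\otimes F_j(k))+\sum_j g_{ij}(F_i(k)\otimes E_j(k)-E_i(k)\otimes F_j(k))$, $i\in\Omega_{PQ}$; (T-V) $(v_i^{sp})^2\rho(k)=E_i(k)\otimes E_i(k)+F_i(k)\otimes F_i(k)$, $i\in\Omega_{PV}$; (T-E) $e_i^{sp}\rho(k)=E_i(k)$ and (T-F) $f_i^{sp}\rho(k)=F_i(k)$, $i\in\Omega_{REF}$. *)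

theory Defs
  imports "HOL-Analysis.Analysis"
begin

definition smooth_near_0 :: "(real \<Rightarrow> real) \<Rightarrow> bool" where
  "smooth_near_0 x \<longleftrightarrow> (\<forall>\<^sub>F t in nhds 0. \<forall>k. (deriv ^^ k) x differentiable at t)"

definition DT :: "(real \<Rightarrow> real) \<Rightarrow> nat \<Rightarrow> real" where
  "DT x k = (deriv ^^ k) x 0 / fact k"

definition conv :: "(nat \<Rightarrow> real) \<Rightarrow> (nat \<Rightarrow> real) \<Rightarrow> nat \<Rightarrow> real" where
  "conv X Y k = (\<Sum>m=0..k. X m * Y (k - m))"

definition rho :: "nat \<Rightarrow> real" where
  "rho k = (if k = 0 then 1 else 0)"

text \<open>
  Buses are the elements of a finite type \<open>'n\<close>, so that \<open>N = CARD('n)\<close>. In the definitions below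
  \<open>g i j\<close> and \<open>b i j\<close> are the real and imaginary parts of the bus admittance matrix, and
  \<open>E i\<close>, \<open>F i\<close>, \<open>L\<close> are the coefficient sequences of the two voltage components of bus \<open>i\<close> and of
  the loading parameter.
\<close>

definition TP :: "('n::finite \<Rightarrow> 'n \<Rightarrow> real) \<Rightarrow> ('n \<Rightarrow> 'n \<Rightarrow> real) \<Rightarrow> ('n \<Rightarrow> real) \<Rightarrow> ('n \<Rightarrow> real) \<Rightarrow>
    ('n \<Rightarrow> nat \<Rightarrow> real) \<Rightarrow> ('n \<Rightarrow> nat \<Rightarrow> real) \<Rightarrow> (nat \<Rightarrow> real) \<Rightarrow> nat \<Rightarrow> 'n \<Rightarrow> bool" where
  "TP g b dp psp E F L k i \<longleftrightarrow>
     psp i * rho k = - dp i * L k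
       + (\<Sum>j\<in>UNIV. g i j * (conv (E i) (E j) k + conv (F i) (F j) k))
       + (\<Sum>j\<in>UNIV. b i j * (conv (F i) (E j) k - conv (E i) (F j) k))"

definition TQ :: "('n::finite \<Rightarrow> 'n \<Rightarrow> real) \<Rightarrow> ('n \<Rightarrow> 'n \<Rightarrow> real) \<Rightarrow> ('n \<Rightarrow> real) \<Rightarrow> ('n \<Rightarrow> real) \<Rightarrow>
    ('n \<Rightarrow> nat \<Rightarrow> real) \<Rightarrow> ('n \<Rightarrow> nat \<Rightarrow> real) \<Rightarrow> (nat \<Rightarrow> real) \<Rightarrow> nat \<Rightarrow> 'n \<Rightarrow> bool" where
  "TQ g b dq qsp E F L k i \<longleftrightarrow>
     qsp i * rho k = - dq i * L k
       - (\<Sum>j\<in>UNIV. b i j * (conv (E i) (E j) k + conv (F i) (F j) k))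
       + (\<Sum>j\<in>UNIV. g i j * (conv (F i) (E j) k - conv (E i) (F j) k))"

definition TV :: "('n \<Rightarrow> real) \<Rightarrow> ('n \<Rightarrow> nat \<Rightarrow> real) \<Rightarrow> ('n \<Rightarrow> nat \<Rightarrow> real) \<Rightarrow> nat \<Rightarrow> 'n \<Rightarrow> bool" where
  "TV vsp E F k i \<longleftrightarrow> (vsp i)\<^sup>2 * rho k = conv (E i) (E i) k + conv (F i) (F i) k"

definition TE :: "('n \<Rightarrow> real) \<Rightarrow> ('n \<Rightarrow> nat \<Rightarrow> real) \<Rightarrow> nat \<Rightarrow> 'n \<Rightarrow> bool" where
  "TE esp E k i \<longleftrightarrow> esp i * rho k = E i k"

definition TF :: "('n \<Rightarrow> real) \<Rightarrow> ('n \<Rightarrow> nat \<Rightarrow> real) \<Rightarrow> nat \<Rightarrow> 'n \<Rightarrow> bool" where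
  "TF fsp F k i \<longleftrightarrow> fsp i * rho k = F i k"

text \<open>
  A vector \<open>[x\<^sub>1, y\<^sub>1, \<dots>, x\<^sub>N, y\<^sub>N]\<close> of length \<open>2N\<close> is represented by its \<open>N\<close> consecutive blocks
  \<open>(x\<^sub>j, y\<^sub>j)\<close>, that is, by an element of the \<open>2N\<close>-dimensional Euclidean space \<open>(real \<times> real) ^ 'n\<close>.
  The product of a row vector with a column vector is then the inner product of this space.
\<close>

definition Yvec :: "('n::finite \<Rightarrow> nat \<Rightarrow> real) \<Rightarrow> ('n \<Rightarrow> nat \<Rightarrow> real) \<Rightarrow> nat \<Rightarrow> (real \<times> real) ^ 'n" where
  "Yvec E F k = (\<chi> j. (E j k, F j k))"

definition alpha :: "('n::finite \<Rightarrow> 'n \<Rightarrow> real) \<Rightarrow> ('n \<Rightarrow> 'n \<Rightarrow> real) \<Rightarrow>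
    ('n \<Rightarrow> nat \<Rightarrow> real) \<Rightarrow> ('n \<Rightarrow> nat \<Rightarrow> real) \<Rightarrow> 'n \<Rightarrow> 'n \<Rightarrow> real" where
  "alpha g b E F i j =
     (if j = i
      then (\<Sum>l\<in>UNIV. g i l * E l 0 - b i l * F l 0) + g i i * E i 0 + b i i * F i 0
      else g i j * E i 0 + b i j * F i 0)"

definition beta :: "('n::finite \<Rightarrow> 'n \<Rightarrow> real) \<Rightarrow> ('n \<Rightarrow> 'n \<Rightarrow> real) \<Rightarrow>
    ('n \<Rightarrow> nat \<Rightarrow> real) \<Rightarrow> ('n \<Rightarrow> nat \<Rightarrow> real) \<Rightarrow> 'n \<Rightarrow> 'n \<Rightarrow> real" where
  "beta g b E F i j =
     (if j = i
      then (\<Sum>l\<in>UNIV. b i l * E l 0 + g i l * F l 0) - b i i * E i 0 + g i i * F i 0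
      else g i j * F i 0 - b i j * E i 0)"

definition phi :: "('n::finite \<Rightarrow> 'n \<Rightarrow> real) \<Rightarrow> ('n \<Rightarrow> 'n \<Rightarrow> real) \<Rightarrow>
    ('n \<Rightarrow> nat \<Rightarrow> real) \<Rightarrow> ('n \<Rightarrow> nat \<Rightarrow> real) \<Rightarrow> 'n \<Rightarrow> 'n \<Rightarrow> real" where
  "phi g b E F i j =
     (if j = i
      then - (\<Sum>l\<in>UNIV. b i l * E l 0 + g i l * F l 0) - b i i * E i 0 + g i i * F i 0
      else - b i j * E i 0 + g i j * F i 0)"

definition psi :: "('n::finite \<Rightarrow> 'n \<Rightarrow> real) \<Rightarrow> ('n \<Rightarrow> 'n \<Rightarrow> real) \<Rightarrow>
    ('n \<Rightarrow> nat \<Rightarrow> real) \<Rightarrow> ('n \<Rightarrow> nat \<Rightarrow> real) \<Rightarrow> 'n \<Rightarrow> 'n \<Rightarrow> real" where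
  "psi g b E F i j =
     (if j = i
      then (\<Sum>l\<in>UNIV. g i l * E l 0 - b i l * F l 0) - g i i * E i 0 - b i i * F i 0
      else - b i j * F i 0 - g i j * E i 0)"

definition aP :: "('n::finite \<Rightarrow> 'n \<Rightarrow> real) \<Rightarrow> ('n \<Rightarrow> 'n \<Rightarrow> real) \<Rightarrow>
    ('n \<Rightarrow> nat \<Rightarrow> real) \<Rightarrow> ('n \<Rightarrow> nat \<Rightarrow> real) \<Rightarrow> 'n \<Rightarrow> (real \<times> real) ^ 'n" where
  "aP g b E F i = (\<chi> j. (alpha g b E F i j, beta g b E F i j))"

definition aQ :: "('n::finite \<Rightarrow> 'n \<Rightarrow> real) \<Rightarrow> ('n \<Rightarrow> 'n \<Rightarrow> real) \<Rightarrow>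
    ('n \<Rightarrow> nat \<Rightarrow> real) \<Rightarrow> ('n \<Rightarrow> nat \<Rightarrow> real) \<Rightarrow> 'n \<Rightarrow> (real \<times> real) ^ 'n" where
  "aQ g b E F i = (\<chi> j. (phi g b E F i j, psi g b E F i j))"

definition aV :: "('n::finite \<Rightarrow> nat \<Rightarrow> real) \<Rightarrow> ('n \<Rightarrow> nat \<Rightarrow> real) \<Rightarrow> 'n \<Rightarrow> (real \<times> real) ^ 'n" where
  "aV E F i = (\<chi> j. if j = i then (2 * E i 0, 2 * F i 0) else (0, 0))"

definition aE :: "'n::finite \<Rightarrow> (real \<times> real) ^ 'n" where
  "aE i = (\<chi> j. if j = i then (1, 0) else (0, 0))"

definition aF :: "'n::finite \<Rightarrow> (real \<times> real) ^ 'n" where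
  "aF i = (\<chi> j. if j = i then (0, 1) else (0, 0))"

definition cross_c :: "('n \<Rightarrow> nat \<Rightarrow> real) \<Rightarrow> ('n \<Rightarrow> nat \<Rightarrow> real) \<Rightarrow> nat \<Rightarrow> 'n \<Rightarrow> 'n \<Rightarrow> real" where
  "cross_c E F k i j = (\<Sum>m=1..k-1. E i m * E j (k - m)) + (\<Sum>m=1..k-1. F i m * F j (k - m))"

definition cross_d :: "('n \<Rightarrow> nat \<Rightarrow> real) \<Rightarrow> ('n \<Rightarrow> nat \<Rightarrow> real) \<Rightarrow> nat \<Rightarrow> 'n \<Rightarrow> 'n \<Rightarrow> real" where
  "cross_d E F k i j = (\<Sum>m=1..k-1. F i m * E j (k - m)) - (\<Sum>m=1..k-1. E i m * F j (k - m))"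

definition eps :: "('n::finite \<Rightarrow> 'n \<Rightarrow> real) \<Rightarrow> ('n \<Rightarrow> 'n \<Rightarrow> real) \<Rightarrow> ('n \<Rightarrow> real) \<Rightarrow>
    ('n \<Rightarrow> nat \<Rightarrow> real) \<Rightarrow> ('n \<Rightarrow> nat \<Rightarrow> real) \<Rightarrow> nat \<Rightarrow> 'n \<Rightarrow> real" where
  "eps g b psp E F k i =
     (\<Sum>j\<in>UNIV. g i j * cross_c E F k i j) + (\<Sum>j\<in>UNIV. b i j * cross_d E F k i j) - psp i * rho k"

definition mu :: "('n::finite \<Rightarrow> 'n \<Rightarrow> real) \<Rightarrow> ('n \<Rightarrow> 'n \<Rightarrow> real) \<Rightarrow> ('n \<Rightarrow> real) \<Rightarrow>
    ('n \<Rightarrow> nat \<Rightarrow> real) \<Rightarrow> ('n \<Rightarrow> nat \<Rightarrow> real) \<Rightarrow> nat \<Rightarrow> 'n \<Rightarrow> real" where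
  "mu g b qsp E F k i =
     - (\<Sum>j\<in>UNIV. b i j * cross_c E F k i j) + (\<Sum>j\<in>UNIV. g i j * cross_d E F k i j) - qsp i * rho k"

definition varsigma :: "('n \<Rightarrow> real) \<Rightarrow>
    ('n \<Rightarrow> nat \<Rightarrow> real) \<Rightarrow> ('n \<Rightarrow> nat \<Rightarrow> real) \<Rightarrow> nat \<Rightarrow> 'n \<Rightarrow> real" where
  "varsigma vsp E F k i = cross_c E F k i i - (vsp i)\<^sup>2 * rho k"

end

theory Submission
  imports Defs
begin

text \<open>The two end terms are the only ones with a value of order \<open>k\<close>; the
  remaining sum uses orders strictly between 0 and \<open>k\<close> and feeds the constant part of
  the linear equations.\<close>

lemma conv_split_ends:
  assumes "k \<ge> 1"
  shows "conv X Y k = X 0 * Y k + X k * Y 0 + (\<Sum>m=1..k-1. X m * Y (k - m))"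
proof -
  have "{0..k} = insert 0 (insert k {1..k-1})"
    using assms by auto
  then show ?thesis
    \<comment> \<open>As \<open>k \<ge> 1\<close>, the elements 0 and \<open>k\<close> are distinct
      and lie outside \<open>{1..k-1}\<close>, so each gives its own term. For \<open>k = 1\<close>
      the middle sum is empty.\<close>
    using assms by (simp add: conv_def)
qed

lemma inner_blocks_Yvec:
  "(\<chi> j. (x j, y j)) \<bullet> Yvec E F k = (\<Sum>j\<in>UNIV. x j * E j k + y j * F j k)"
  by (simp add: inner_vec_def Yvec_def)

text \<open>Serves the rows \<open>aV\<close>, \<open>aE\<close> and \<open>aF\<close>, which vanish
  outside the block of bus \<open>i\<close>.\<close>

lemma inner_single_block_Yvec:
  "(\<chi> j. if j = i then (s, t) else (0, 0)) \<bullet> Yvec E F k = s * E i k + t * F i k"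
proof -
  have "(\<chi> j. if j = i then (s, t) else (0, 0)) \<bullet> Yvec E F k
      = (\<Sum>j\<in>UNIV. if j = i then s * E j k + t * F j k else 0)"
    unfolding inner_vec_def by (rule sum.cong) (simp_all add: Yvec_def)
  then show ?thesis by simp
qed

text \<open>The sums over all buses in the diagonal entries come from the terms in which the unknown
  of order \<open>k\<close> is that of bus \<open>i\<close> itself; separated from the diagonal, they leave the summand of
  bus \<open>j = i\<close> in the same form as all others.\<close>

lemma inner_blocks_diag_Yvec:
  assumes x: "\<And>j. x j = (if j = i then s else 0) + u j"
    and y: "\<And>j. y j = (if j = i then t else 0) + v j"
  shows "(\<chi> j. (x j, y j)) \<bullet> Yvec E F k
    = s * E i k + t * F i k + (\<Sum>j\<in>UNIV. u j * E j k + v j * F j k)"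
proof -
  have "(\<chi> j. (x j, y j)) \<bullet> Yvec E F k
      = (\<Sum>j\<in>UNIV. (if j = i then s * E j k + t * F j k else 0) + (u j * E j k + v j * F j k))"
    unfolding inner_blocks_Yvec x y by (rule sum.cong) (auto simp: algebra_simps)
  then show ?thesis by (simp add: sum.distrib)
qed

text \<open>The right-hand side collects exactly the end terms of the convolutions in
  \<open>TP\<close>, so the row accounts for everything of order \<open>k\<close> in the
  voltages.\<close>

lemma aP_inner_Yvec:
  "aP g b E F i \<bullet> Yvec E F k
    = (\<Sum>j\<in>UNIV. g i j * (E i 0 * E j k + E i k * E j 0 + F i 0 * F j k + F i k * F j 0)
                + b i j * (F i 0 * E j k + F i k * E j 0 - E i 0 * F j k - E i k * F j 0))"
proof -
  have "aP g b E F i \<bullet> Yvec E F k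
      = (\<Sum>l\<in>UNIV. g i l * E l 0 - b i l * F l 0) * E i k
        + (\<Sum>l\<in>UNIV. b i l * E l 0 + g i l * F l 0) * F i k
        + (\<Sum>j\<in>UNIV. (g i j * E i 0 + b i j * F i 0) * E j k
                    + (g i j * F i 0 - b i j * E i 0) * F j k)"
    \<comment> \<open>The off-diagonal formula, read at \<open>j = i\<close>, gives the trailing
      terms of the diagonal entry, so it can serve as \<open>u\<close> and \<open>v\<close> for
      every bus; \<open>s\<close> and \<open>t\<close> are the sums over all buses.\<close>
    unfolding aP_def by (rule inner_blocks_diag_Yvec) (simp_all add: alpha_def beta_def)
  then show ?thesis
    by (simp only: sum_distrib_right sum.distrib [symmetric])
       (auto intro!: sum.cong simp: algebra_simps)
qed

text \<open>The same mechanism as for \<open>aP\<close>, with \<open>g\<close> replaced by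
  \<open>-b\<close> and \<open>b\<close> by \<open>g\<close>.\<close>

lemma aQ_inner_Yvec:
  "aQ g b E F i \<bullet> Yvec E F k
    = (\<Sum>j\<in>UNIV. g i j * (F i 0 * E j k + F i k * E j 0 - E i 0 * F j k - E i k * F j 0)
                - b i j * (E i 0 * E j k + E i k * E j 0 + F i 0 * F j k + F i k * F j 0))"
proof -
  have "aQ g b E F i \<bullet> Yvec E F k
      = (- (\<Sum>l\<in>UNIV. b i l * E l 0 + g i l * F l 0)) * E i k
        + (\<Sum>l\<in>UNIV. g i l * E l 0 - b i l * F l 0) * F i k
        + (\<Sum>j\<in>UNIV. (- b i j * E i 0 + g i j * F i 0) * E j k
                    + (- b i j * F i 0 - g i j * E i 0) * F j k)"
    unfolding aQ_def by (rule inner_blocks_diag_Yvec) (simp_all add: phi_def psi_def)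
  then show ?thesis
    by (simp only: sum_distrib_right sum.distrib [symmetric] sum_negf [symmetric])
       (auto intro!: sum.cong simp: algebra_simps)
qed

text \<open>The loading term is already linear in \<open>L k\<close>, so only the bilinear sums need
  rewriting.\<close>

lemma TP_iff_linear:
  assumes "k \<ge> 1"
  shows "TP g b dp psp E F L k i \<longleftrightarrow>
    0 = aP g b E F i \<bullet> Yvec E F k - dp i * L k + eps g b psp E F k i"
proof -
  have "(\<Sum>j\<in>UNIV. g i j * (conv (E i) (E j) k + conv (F i) (F j) k))
        + (\<Sum>j\<in>UNIV. b i j * (conv (F i) (E j) k - conv (E i) (F j) k))
      = aP g b E F i \<bullet> Yvec E F k
        + (\<Sum>j\<in>UNIV. g i j * cross_c E F k i j) + (\<Sum>j\<in>UNIV. b i j * cross_d E F k i j)"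
    \<comment> \<open>Merging each side into one sum over \<open>j\<close> reduces the claim to an
      algebraic identity for each bus.\<close>
    unfolding aP_inner_Yvec sum.distrib [symmetric]
    by (rule sum.cong) (simp_all add: conv_split_ends [OF assms] cross_c_def cross_d_def algebra_simps)
  then show ?thesis
    unfolding TP_def eps_def by auto
qed

lemma TQ_iff_linear:
  assumes "k \<ge> 1"
  shows "TQ g b dq qsp E F L k i \<longleftrightarrow>
    0 = aQ g b E F i \<bullet> Yvec E F k - dq i * L k + mu g b qsp E F k i"
proof -
  have "(\<Sum>j\<in>UNIV. g i j * (conv (F i) (E j) k - conv (E i) (F j) k))
        - (\<Sum>j\<in>UNIV. b i j * (conv (E i) (E j) k + conv (F i) (F j) k))
      = aQ g b E F i \<bullet> Yvec E F k
        + (\<Sum>j\<in>UNIV. g i j * cross_d E F k i j) - (\<Sum>j\<in>UNIV. b i j * cross_c E F k i j)"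
    unfolding aQ_inner_Yvec sum.distrib [symmetric] sum_subtractf [symmetric]
    by (rule sum.cong) (simp_all add: conv_split_ends [OF assms] cross_c_def cross_d_def algebra_simps)
  then show ?thesis
    unfolding TQ_def mu_def by auto
qed

text \<open>In the convolution of a sequence with itself the two end terms coincide, whence the
  factor 2 in \<open>aV\<close>.\<close>

lemma TV_iff_linear:
  assumes "k \<ge> 1"
  shows "TV vsp E F k i \<longleftrightarrow> 0 = aV E F i \<bullet> Yvec E F k + varsigma vsp E F k i"
  unfolding TV_def aV_def inner_single_block_Yvec varsigma_def cross_c_def
    conv_split_ends [OF assms]
  by (auto simp: algebra_simps)

lemma TE_iff_linear: "TE esp E k i \<longleftrightarrow> 0 = aE i \<bullet> Yvec E F k - esp i * rho k"
  unfolding TE_def aE_def inner_single_block_Yvec by auto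

lemma TF_iff_linear: "TF fsp F k i \<longleftrightarrow> 0 = aF i \<bullet> Yvec E F k - fsp i * rho k"
  unfolding TF_def aF_def inner_single_block_Yvec by auto

theorem proposition1:
  fixes PQ PV REF :: "'n::finite set"
    and g b :: "'n \<Rightarrow> 'n \<Rightarrow> real"
    and dp dq psp qsp vsp esp fsp :: "'n \<Rightarrow> real"
    and e f :: "'n \<Rightarrow> real \<Rightarrow> real" and lam :: "real \<Rightarrow> real"
    and E F :: "'n \<Rightarrow> nat \<Rightarrow> real" and L :: "nat \<Rightarrow> real"
    and k :: nat
  assumes partition: "PQ \<union> PV \<union> REF = UNIV"
      "PQ \<inter> PV = {}" "PQ \<inter> REF = {}" "PV \<inter> REF = {}"
    and smooth: "\<And>i. smooth_near_0 (e i)" "\<And>i. smooth_near_0 (f i)" "smooth_near_0 lam"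
    and E: "\<And>i. E i = DT (e i)" and F: "\<And>i. F i = DT (f i)" and L: "L = DT lam"
    and k: "k \<ge> 1"
  shows
    "(\<forall>i \<in> PQ \<union> PV. TP g b dp psp E F L k i \<longleftrightarrow>
        0 = aP g b E F i \<bullet> Yvec E F k - dp i * L k + eps g b psp E F k i) \<and>
     (\<forall>i \<in> PQ. TQ g b dq qsp E F L k i \<longleftrightarrow>
        0 = aQ g b E F i \<bullet> Yvec E F k - dq i * L k + mu g b qsp E F k i) \<and>
     (\<forall>i \<in> PV. TV vsp E F k i \<longleftrightarrow>
        0 = aV E F i \<bullet> Yvec E F k + 0 * L k + varsigma vsp E F k i) \<and>
     (\<forall>i \<in> REF. TE esp E k i \<longleftrightarrow>
        0 = aE i \<bullet> Yvec E F k + 0 * L k - esp i * rho k) \<and>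
     (\<forall>i \<in> REF. TF fsp F k i \<longleftrightarrow>
        0 = aF i \<bullet> Yvec E F k + 0 * L k - fsp i * rho k)"
  \<comment> \<open>Once the zero multiples of \<open>L k\<close> are removed, each conjunct is one
    of the equivalences above.\<close>
  by (simp only: TP_iff_linear [OF k] TQ_iff_linear [OF k] TV_iff_linear [OF k]
        TE_iff_linear TF_iff_linear mult_zero_left add_0_right) simp

end
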